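(* Let $d$ be a positive integer and let $\mathcal{S}$ be a finite family of pairwise disjoint closed balls (of arbitrary positive radii) in $\mathbb{R}^d$. Fix a linear ordering of $\mathcal{S}$. Then the set of directions in $S^{d-1}$ of all oriented lines that intersect all the balls of $\mathcal{S}$ in this specified order is a strictly convex subset of the sphere $S^{d-1}$.
   Context: The direction of an oriented line in $\mathbb{R}^d$ is its unit direction vector in $S^{d-1}$. An oriented line meets the disjoint balls $B_1,\dots,B_n$ in the order $B_1\prec\dots\prec B_n$ if it intersects every $B_i$ and, traversed along its orientation, meets $B_1$ first, then $B_2$, and so on. A subset $K\subset S^{d-1}$ is convex if for any two non-antipodal points of $K$ the shorter great-circle arc joining them is contained in $K$; it is strictly convex if moreover, when the two points are distinct, the relatively open arc lies in the interior of $K$ in $S^{d-1}$. (The set may be empty or a single point.) *)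

theory Defs
  imports "HOL-Analysis.Analysis"
begin

text \<open>
  An oriented line is given by a point \<open>p\<close> and a unit direction vector \<open>u\<close>; it is traversed
  as \<open>t \<mapsto> p + t u\<close> with \<open>t\<close> increasing. The order \<open>R\<close> on the family is reflexive, hence
  the condition \<open>A \<noteq> B\<close>. For disjoint convex sets, the parameters at which the line is in \<open>A\<close>
  and those at which it is in \<open>B\<close> form disjoint intervals, so that comparing all of them is
  the same as comparing the times of first meeting.
\<close>

definition meets_in_order ::
  "'a::real_normed_vector \<Rightarrow> 'a \<Rightarrow> 'a set set \<Rightarrow> 'a set rel \<Rightarrow> bool" where
  "meets_in_order p u \<S> R \<longleftrightarrow>
     (\<forall>B\<in>\<S>. \<exists>t. p + t *\<^sub>R u \<in> B) \<and>
     (\<forall>A\<in>\<S>. \<forall>B\<in>\<S>. (A, B) \<in> R \<and> A \<noteq> B \<longrightarrow>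
        (\<forall>s t. p + s *\<^sub>R u \<in> A \<and> p + t *\<^sub>R u \<in> B \<longrightarrow> s < t))"

definition transversal_directions ::
  "'a::real_normed_vector set set \<Rightarrow> 'a set rel \<Rightarrow> 'a set" where
  "transversal_directions \<S> R = {u \<in> sphere 0 1. \<exists>p. meets_in_order p u \<S> R}"

text \<open>
  For non-antipodal unit vectors \<open>x\<close> and \<open>y\<close>, the points of the unit sphere in the convex cone
  spanned by \<open>x\<close> and \<open>y\<close> form the shorter great-circle arc from \<open>x\<close> to \<open>y\<close>
  (which is the point \<open>x\<close> if \<open>x = y\<close>). It is not used for antipodal points.
\<close>

definition great_circle_arc :: "'a::real_normed_vector \<Rightarrow> 'a \<Rightarrow> 'a set" where
  "great_circle_arc x y =
     {z \<in> sphere 0 1. \<exists>a b. 0 \<le> a \<and> 0 \<le> b \<and> z = a *\<^sub>R x + b *\<^sub>R y}"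

definition spherically_convex :: "'a::real_normed_vector set \<Rightarrow> bool" where
  "spherically_convex K \<longleftrightarrow>
     K \<subseteq> sphere 0 1 \<and>
     (\<forall>x\<in>K. \<forall>y\<in>K. y \<noteq> - x \<longrightarrow> great_circle_arc x y \<subseteq> K)"

definition strictly_spherically_convex :: "'a::real_normed_vector set \<Rightarrow> bool" where
  "strictly_spherically_convex K \<longleftrightarrow>
     spherically_convex K \<and>
     (\<forall>x\<in>K. \<forall>y\<in>K. y \<noteq> - x \<and> x \<noteq> y \<longrightarrow>
        great_circle_arc x y - {x, y} \<subseteq> top_of_set (sphere 0 1) interior_of K)"

end

theory Submission
  imports Defs
begin

text \<open>
  Let two lines with directions \<open>u\<close> and \<open>v \<noteq> u, - u\<close> meet all the balls in the given order, and let
  \<open>w = a u + b v\<close> be a unit vector with \<open>a, b > 0\<close>. The task is to find a line of direction \<open>w\<close>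
  that meets the interior of every ball: the ball centres are ordered along \<open>w\<close> because they are
  ordered along \<open>u\<close> and along \<open>v\<close>, and for disjoint balls met by a line the order of the centres
  along it is the order in which it meets the balls (\<open>order_iff_centres\<close>). A line through the
  interiors stays transversal when it is turned slightly about one of its points, so \<open>w\<close> is then an
  interior point of the set of directions (\<open>in_interior_if_strict_transversal\<close>).

  A first candidate is a weighted mean of the two given lines, which has direction \<open>w\<close> and whose
  distance to any point is at most \<open>a\<close> times the distance of that point to the first line plus
  \<open>b\<close> times its distance to the second one (\<open>line_combination\<close>). As \<open>a + b > 1\<close>, this bound
  does not exclude that the mean line misses a ball. What it does inherit is a condition on pairs
  of balls. Let the balls have centres \<open>c\<close>, \<open>c'\<close> and radii \<open>r\<close>, \<open>r'\<close>, let \<open>m\<close> be the point that divides the segment from \<open>c\<close>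
  to \<open>c'\<close> in the ratio \<open>r : r'\<close>, and put \<open>\<kappa> = r r' / (r + r')\<^sup>2\<close> and
  \<open>g = \<kappa> (dist c c'\<^sup>2 - (r + r')\<^sup>2)\<close>. A line of unit direction \<open>u\<close> that meets both balls, the
  first one first, has a distance \<open>\<delta>\<close> to \<open>m\<close> with
  \<open>sqrt (\<delta>\<^sup>2 + g) \<le> sqrt \<kappa> ((c' - c) \<bullet> u)\<close>. Disjointness says that \<open>g > 0\<close>, so the left side is a
  norm of the pair \<open>(\<delta>, sqrt g)\<close>, while the right side is linear in \<open>u\<close>; such an inequality passes
  to the mean line, and becomes strict because \<open>a + b > 1\<close> (\<open>pair_on_combined_line\<close>).

  For the mean line, with distances \<open>\<delta>\<^sub>i\<close> to the centres and radii \<open>r\<^sub>i\<close>, the condition says that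
  the numbers \<open>(\<delta>\<^sub>i\<^sup>2 - r\<^sub>i\<^sup>2) / r\<^sub>i\<close> of any two balls have a negative sum. Hence at most one ball is
  not met in its interior, and a parallel shift of the line towards that ball by just more than
  the missing amount does not lose any other ball (\<open>balls_have_common_interior_point\<close>).
\<close>

section \<open>Lines and balls\<close>

definition rejection :: "'a::real_inner \<Rightarrow> 'a \<Rightarrow> 'a" where
  "rejection u x = x - (x \<bullet> u) *\<^sub>R u"

lemma rejection_add: "rejection u (x + y) = rejection u x + rejection u y"
  and rejection_diff: "rejection u (x - y) = rejection u x - rejection u y"
  and rejection_scaleR: "rejection u (k *\<^sub>R x) = k *\<^sub>R rejection u x"
  by (simp_all add: rejection_def inner_left_distrib inner_diff_left algebra_simps)

lemma rejection_shift:
  "norm u = 1 \<Longrightarrow> rejection u (x + k *\<^sub>R u) = rejection u x"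
  by (simp add: rejection_def inner_add_left algebra_simps norm_eq_1)

lemma rejection_idem:
  "norm u = 1 \<Longrightarrow> rejection u (rejection u x) = rejection u x"
  by (simp add: rejection_def inner_diff_left norm_eq_1)

lemma norm_rejection:
  fixes u :: "'a::real_inner"
  assumes "norm u = 1"
  shows "(norm (rejection u x))\<^sup>2 = (norm x)\<^sup>2 - (x \<bullet> u)\<^sup>2"
proof -
  have "u \<bullet> u = 1" using assms by (simp add: norm_eq_1)
  then show ?thesis
    unfolding rejection_def power2_norm_eq_inner
    by (simp add: inner_diff_left inner_diff_right inner_commute power2_eq_square algebra_simps)
qed

lemma dist_foot:
  "dist c (p + ((c - p) \<bullet> u) *\<^sub>R u) = norm (rejection u (c - p))"
  by (simp add: rejection_def dist_norm algebra_simps)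

lemma norm_rejection_le_dist:
  fixes u :: "'a::real_inner"
  assumes "norm u = 1"
  shows "norm (rejection u (c - p)) \<le> dist c (p + t *\<^sub>R u)"
proof -
  have uu: "u \<bullet> u = 1" using assms by (simp add: norm_eq_1)
  have *: "rejection u (c - (p + t *\<^sub>R u)) = rejection u (c - p)"
    using uu by (simp add: rejection_def inner_diff_left inner_add_left algebra_simps)
  have "(norm (rejection u (c - (p + t *\<^sub>R u))))\<^sup>2 \<le> (norm (c - (p + t *\<^sub>R u)))\<^sup>2"
    by (simp add: norm_rejection[OF assms])
  then show ?thesis unfolding * dist_norm by (rule power2_le_imp_le) simp
qed

lemma line_meets_cball_iff:
  fixes u :: "'a::real_inner"
  assumes "norm u = 1"
  shows "(\<exists>t. p + t *\<^sub>R u \<in> cball c r) \<longleftrightarrow> norm (rejection u (c - p)) \<le> r"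
proof
  show "norm (rejection u (c - p)) \<le> r" if "\<exists>t. p + t *\<^sub>R u \<in> cball c r"
    using that order_trans[OF norm_rejection_le_dist[OF assms]] unfolding mem_cball by blast
  show "\<exists>t. p + t *\<^sub>R u \<in> cball c r" if "norm (rejection u (c - p)) \<le> r"
    using that unfolding dist_foot[symmetric] mem_cball by blast
qed

lemma disjnt_cball_imp_dist:
  fixes c :: "'a::real_normed_vector"
  assumes "disjnt (cball c r) (cball c' r')" and r: "0 < r" "0 < r'"
  shows "r + r' < dist c c'"
proof (rule ccontr)
  assume "\<not> r + r' < dist c c'"
  then have le: "dist c c' / (r + r') \<le> 1" using r by simp
  (* the point dividing the segment from c to c' in the ratio of the radii *)
  define m where "m = c + (r / (r + r')) *\<^sub>R (c' - c)"
  have "dist c m = r * (dist c c' / (r + r'))"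
    using r by (simp add: m_def dist_norm norm_minus_commute)
  then have "m \<in> cball c r" using le r mult_left_mono[OF le, of r] by simp
  moreover have "c' - m = (r' / (r + r')) *\<^sub>R (c' - c)"
  proof -
    have "r' / (r + r') = 1 - r / (r + r')" using r by (simp add: field_simps)
    then show ?thesis by (simp add: m_def scaleR_diff_left)
  qed
  then have "dist c' m = r' * (dist c c' / (r + r'))"
    using r by (simp add: dist_norm norm_minus_commute)
  then have "m \<in> cball c' r'" using le r mult_left_mono[OF le, of r'] by simp
  ultimately show False using assms(1) by (auto simp: disjnt_def)
qed

text \<open>
  The foot of the perpendicular from the centre of a ball lies in the ball whenever the line meets
  it, so the parameters of the feet are among those compared. Conversely, suppose the feet are in
  the right order but two other points of the line in the balls are not. While the feet move to
  these points at constant speeds in the same time, the two parameters coincide at some moment,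
  which gives a common point of the two convex balls.
\<close>

lemma order_iff_centres:
  fixes u :: "'a::real_inner"
  assumes u: "norm u = 1" and disj: "disjnt (cball c r) (cball c' r')"
    and meets: "p + s\<^sub>1 *\<^sub>R u \<in> cball c r" "p + t\<^sub>1 *\<^sub>R u \<in> cball c' r'"
  shows "(\<forall>s t. p + s *\<^sub>R u \<in> cball c r \<and> p + t *\<^sub>R u \<in> cball c' r' \<longrightarrow> s < t)
    \<longleftrightarrow> 0 < (c' - c) \<bullet> u"
proof -
  define s0 t0 where "s0 = (c - p) \<bullet> u" and "t0 = (c' - p) \<bullet> u"
  have s0: "p + s0 *\<^sub>R u \<in> cball c r"
    using order_trans[OF norm_rejection_le_dist[OF u] meets(1)[unfolded mem_cball]]
    unfolding mem_cball s0_def dist_foot .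
  have t0: "p + t0 *\<^sub>R u \<in> cball c' r'"
    using order_trans[OF norm_rejection_le_dist[OF u] meets(2)[unfolded mem_cball]]
    unfolding mem_cball t0_def dist_foot .
  have eq: "(c' - c) \<bullet> u = t0 - s0"
    by (simp add: s0_def t0_def inner_diff_left)
  have "s < t" if lt: "s0 < t0" and s: "p + s *\<^sub>R u \<in> cball c r" and t: "p + t *\<^sub>R u \<in> cball c' r'" for s t
  proof (rule ccontr)
    assume "\<not> s < t"
    (* the moment at which the two moving parameters coincide *)
    define k where "k = (t0 - s0) / ((t0 - s0) + (s - t))"
    have pos: "(t0 - s0) + (s - t) > 0" using lt \<open>\<not> s < t\<close> by linarith
    have k: "0 \<le> k" "k \<le> 1" using lt \<open>\<not> s < t\<close> pos by (auto simp: k_def field_simps)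
    have "k * ((t0 - s0) + (s - t)) = t0 - s0" using pos by (simp add: k_def)
    then have same: "(1 - k) * s0 + k * s = (1 - k) * t0 + k * t" by (simp add: algebra_simps)
    have seg: "(1 - k) *\<^sub>R (p + x *\<^sub>R u) + k *\<^sub>R (p + y *\<^sub>R u) = p + ((1 - k) * x + k * y) *\<^sub>R u" for x y
      by (simp add: algebra_simps)
    have "p + ((1 - k) * s0 + k * s) *\<^sub>R u \<in> cball c r"
      using convexD_alt[OF convex_cball s0 s k] by (simp add: seg)
    moreover have "p + ((1 - k) * s0 + k * s) *\<^sub>R u \<in> cball c' r'"
      using convexD_alt[OF convex_cball t0 t k] by (simp add: seg same)
    ultimately show False using disj by (auto simp: disjnt_def)
  qed
  then show ?thesis using s0 t0 by (auto simp: eq)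
qed

section \<open>A mean of two lines\<close>

lemma coefficients_of_arc_point:
  fixes u v :: "'a::real_inner"
  assumes "norm u = 1" "norm v = 1" "v \<noteq> u" "0 < a" "0 < b" "norm (a *\<^sub>R u + b *\<^sub>R v) = 1"
  shows "1 < a + b"
proof (rule ccontr)
  assume "\<not> 1 < a + b"
  then have "norm (a *\<^sub>R u + b *\<^sub>R v) = norm (a *\<^sub>R u) + norm (b *\<^sub>R v)"
    using norm_triangle_ineq[of "a *\<^sub>R u" "b *\<^sub>R v"] assms by simp
  then have "norm (a *\<^sub>R u) *\<^sub>R b *\<^sub>R v = norm (b *\<^sub>R v) *\<^sub>R a *\<^sub>R u"
    by (rule iffD1[OF norm_triangle_eq])
  then have "(a * b) *\<^sub>R v = (a * b) *\<^sub>R u"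
    using assms by (simp add: mult.commute)
  then show False using assms by simp
qed

text \<open>
  The two lines are first moved along themselves to points \<open>p'\<close> and \<open>q'\<close> whose difference is
  orthogonal to \<open>u\<close> and \<open>v\<close>; the weighted mean of \<open>p'\<close> and \<open>q'\<close> is the base point \<open>o'\<close>. The
  distance from \<open>c\<close> to a line is the norm of a pair: a determinant of \<open>c - o'\<close> and the direction
  within the plane of \<open>u\<close> and \<open>v\<close>, and the part orthogonal to that plane. The determinant for
  \<open>a u + b v\<close> is the combination of the other two; in the orthogonal part the combination of the
  other two is even \<open>a + b \<ge> 1\<close> times as long. The triangle inequality for these pairs
  gives the claim.
\<close>

lemma line_combination:
  fixes u v :: "'a::real_inner"
  assumes u: "norm u = 1" and v: "norm v = 1" and uv: "v \<noteq> u" "v \<noteq> - u"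
    and ab: "0 < a" "0 < b" and z: "norm (a *\<^sub>R u + b *\<^sub>R v) = 1"
  shows "\<exists>o'. \<forall>c. norm (rejection (a *\<^sub>R u + b *\<^sub>R v) (c - o'))
           \<le> a * norm (rejection u (c - p)) + b * norm (rejection v (c - q))"
proof -
  define \<gamma> where "\<gamma> = u \<bullet> v"
  have uu: "u \<bullet> u = 1" "v \<bullet> v = 1" "v \<bullet> u = \<gamma>" "u \<bullet> v = \<gamma>"
    using u v by (simp_all add: norm_eq_1 \<gamma>_def inner_commute)
  have "v - u \<noteq> 0" "v + u \<noteq> 0"
    using uv by (auto simp: eq_neg_iff_add_eq_0)
  then have "0 < (v - u) \<bullet> (v - u)" "0 < (v + u) \<bullet> (v + u)"
    unfolding inner_gt_zero_iff .
  then have \<gamma>: "\<gamma> < 1" "- 1 < \<gamma>"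
    unfolding inner_diff_left inner_diff_right inner_add_left inner_add_right uu by linarith+
  have one_le: "1 \<le> a + b"
    using coefficients_of_arc_point[OF u v uv(1) ab z] by simp
  define k2 where "k2 = 1 - \<gamma>\<^sup>2"
  have "0 < (1 - \<gamma>) * (1 + \<gamma>)"
    using \<gamma> by (intro mult_pos_pos) linarith+
  then have k2: "0 < k2" unfolding k2_def power2_eq_square by (simp only: algebra_simps)
  define k where "k = sqrt k2"
  have k: "0 < k" "k\<^sup>2 = k2" using k2 by (simp_all add: k_def)
  (* s and t solve the linear system saying that p' - q' is orthogonal to u and v; its determinant,
     up to sign, is k2 *)
  define t where "t = ((p - q) \<bullet> v - \<gamma> * ((p - q) \<bullet> u)) / k2"
  define s where "s = t * \<gamma> - (p - q) \<bullet> u"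
  have tk: "t * k2 = (p - q) \<bullet> v - \<gamma> * ((p - q) \<bullet> u)" using k2 by (simp add: t_def)
  define p' q' where "p' = p + s *\<^sub>R u" and "q' = q + t *\<^sub>R v"
  define \<delta> where "\<delta> = p' - q'"
  have "\<delta> \<bullet> u = 0"
    by (simp add: \<delta>_def p'_def q'_def inner_diff_left inner_add_left uu s_def)
  have "\<delta> \<bullet> v = (p - q) \<bullet> v - \<gamma> * ((p - q) \<bullet> u) - t * k2"
    by (simp add: \<delta>_def p'_def q'_def inner_diff_left inner_add_left uu s_def k2_def power2_eq_square algebra_simps)
  then have "\<delta> \<bullet> v = 0" using tk by simp
  define o' where "o' = (1 / (a + b)) *\<^sub>R (a *\<^sub>R p' + b *\<^sub>R q')"
  define \<delta>u \<delta>v where "\<delta>u = (b / (a + b)) *\<^sub>R \<delta>" and "\<delta>v = - (a / (a + b)) *\<^sub>R \<delta>"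
  have perp: "\<delta>u \<bullet> u = 0" "\<delta>u \<bullet> v = 0" "\<delta>v \<bullet> u = 0" "\<delta>v \<bullet> v = 0"
    using \<open>\<delta> \<bullet> u = 0\<close> \<open>\<delta> \<bullet> v = 0\<close> by (simp_all add: \<delta>u_def \<delta>v_def)
  have cancel: "a *\<^sub>R \<delta>u + b *\<^sub>R \<delta>v = 0" by (simp add: \<delta>u_def \<delta>v_def algebra_simps)
  have "(a + b) *\<^sub>R \<delta>u = b *\<^sub>R \<delta>" "(a + b) *\<^sub>R \<delta>v = - (a *\<^sub>R \<delta>)"
    using ab by (simp_all add: \<delta>u_def \<delta>v_def)
  moreover have "(a + b) *\<^sub>R o' = a *\<^sub>R p' + b *\<^sub>R q'" using ab by (simp add: o'_def)
  ultimately have "(a + b) *\<^sub>R (o' + \<delta>u) = (a + b) *\<^sub>R p'" "(a + b) *\<^sub>R (o' + \<delta>v) = (a + b) *\<^sub>R q'"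
    unfolding scaleR_add_right[of _ o'] by (simp_all add: \<delta>_def algebra_simps)
  then have p': "p' = o' + \<delta>u" and q': "q' = o' + \<delta>v"
    using ab by simp_all
  (* the orthogonal projection onto the orthogonal complement of the plane of u and v *)
  define \<pi> where "\<pi> y = y - ((y \<bullet> u - \<gamma> * (y \<bullet> v)) / k2) *\<^sub>R u - ((y \<bullet> v - \<gamma> * (y \<bullet> u)) / k2) *\<^sub>R v" for y
  have pyth: "(norm y)\<^sup>2 = (norm (\<pi> y))\<^sup>2 + (y \<bullet> u)\<^sup>2 + (y \<bullet> v - \<gamma> * (y \<bullet> u))\<^sup>2 / k2" for y
  proof -
    define A B where "A = (y \<bullet> u - \<gamma> * (y \<bullet> v)) / k2" and "B = (y \<bullet> v - \<gamma> * (y \<bullet> u)) / k2"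
    have Ak: "A * k2 = y \<bullet> u - \<gamma> * (y \<bullet> v)" and Bk: "B * k2 = y \<bullet> v - \<gamma> * (y \<bullet> u)"
      using k2 by (simp_all add: A_def B_def)
    have "(A + \<gamma> * B) * k2 = A * k2 + \<gamma> * (B * k2)" "(B + \<gamma> * A) * k2 = B * k2 + \<gamma> * (A * k2)"
      by (simp_all add: algebra_simps)
    then have "(A + \<gamma> * B) * k2 = (y \<bullet> u) * k2" "(B + \<gamma> * A) * k2 = (y \<bullet> v) * k2"
      unfolding Ak Bk by (simp_all add: k2_def power2_eq_square algebra_simps)
    then have AB: "y \<bullet> u = A + \<gamma> * B" "y \<bullet> v = B + \<gamma> * A"
      using k2 by simp_all
    have "(norm (\<pi> y))\<^sup>2 = (norm y)\<^sup>2 - 2 * A * (y \<bullet> u) - 2 * B * (y \<bullet> v) + A\<^sup>2 + B\<^sup>2 + 2 * A * B * \<gamma>"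
      unfolding \<pi>_def A_def[symmetric] B_def[symmetric] power2_norm_eq_inner
      by (simp add: inner_diff_left inner_diff_right uu inner_commute[of u y] inner_commute[of v y] power2_eq_square algebra_simps)
    moreover have "(y \<bullet> v - \<gamma> * (y \<bullet> u))\<^sup>2 / k2 = B\<^sup>2 * k2"
      using k2 by (simp add: B_def power2_eq_square)
    ultimately show ?thesis unfolding AB k2_def by (simp add: power2_eq_square algebra_simps)
  qed
  have "norm (rejection (a *\<^sub>R u + b *\<^sub>R v) (c - o'))
           \<le> a * norm (rejection u (c - p)) + b * norm (rejection v (c - q))" for c
  proof -
    define m where "m = c - o'"
    define x y where "x = m \<bullet> u" and "y = m \<bullet> v"
    (* the determinants of m with u and v, in the orthonormal basis of the plane in which
       u = (1, 0) and v = (\<gamma>, k) *)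
    define Fu Fv where "Fu = (\<gamma> * x - y) / k" and "Fv = (x - \<gamma> * y) / k"
    have \<pi>u: "\<pi> (m - \<delta>u) = \<pi> m - \<delta>u" and \<pi>v: "\<pi> (m - \<delta>v) = \<pi> m - \<delta>v"
      by (simp_all add: \<pi>_def inner_diff_left perp)
    have cp: "c - p = (m - \<delta>u) + s *\<^sub>R u"
      using p' by (simp add: p'_def m_def algebra_simps)
    have cq: "c - q = (m - \<delta>v) + t *\<^sub>R v"
      using q' by (simp add: q'_def m_def algebra_simps)
    have "(norm (rejection u (c - p)))\<^sup>2 = (norm (Fu, \<pi> m - \<delta>u))\<^sup>2"
    proof -
      have "(norm (rejection u (c - p)))\<^sup>2 = (norm (m - \<delta>u))\<^sup>2 - x\<^sup>2"
        unfolding cp rejection_shift[OF u] norm_rejection[OF u] by (simp add: x_def inner_diff_left perp)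
      also have "\<dots> = (norm (\<pi> m - \<delta>u))\<^sup>2 + (y - \<gamma> * x)\<^sup>2 / k2"
        using pyth[of "m - \<delta>u"] by (simp add: \<pi>u inner_diff_left perp x_def y_def)
      also have "(y - \<gamma> * x)\<^sup>2 / k2 = Fu\<^sup>2"
        by (simp add: Fu_def power_divide k power2_commute)
      finally show ?thesis by (simp add: norm_Pair)
    qed
    then have ru: "norm (rejection u (c - p)) = norm (Fu, \<pi> m - \<delta>u)"
      by simp
    have "(norm (rejection v (c - q)))\<^sup>2 = (norm (Fv, \<pi> m - \<delta>v))\<^sup>2"
    proof -
      have "(norm (rejection v (c - q)))\<^sup>2 = (norm (m - \<delta>v))\<^sup>2 - y\<^sup>2"
        unfolding cq rejection_shift[OF v] norm_rejection[OF v] by (simp add: y_def inner_diff_left perp)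
      also have "\<dots> = (norm (\<pi> m - \<delta>v))\<^sup>2 + (x\<^sup>2 - y\<^sup>2 + (y - \<gamma> * x)\<^sup>2 / k2)"
        using pyth[of "m - \<delta>v"] by (simp add: \<pi>v inner_diff_left perp x_def y_def)
      also have "x\<^sup>2 - y\<^sup>2 + (y - \<gamma> * x)\<^sup>2 / k2 = ((x\<^sup>2 - y\<^sup>2) * k2 + (y - \<gamma> * x)\<^sup>2) / k2"
        using k2 by (simp add: add_divide_distrib)
      also have "(x\<^sup>2 - y\<^sup>2) * k2 + (y - \<gamma> * x)\<^sup>2 = (x - \<gamma> * y)\<^sup>2"
        by (simp add: k2_def power2_eq_square algebra_simps)
      also have "(x - \<gamma> * y)\<^sup>2 / k2 = Fv\<^sup>2"
        by (simp add: Fv_def power_divide k)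
      finally show ?thesis by (simp add: norm_Pair)
    qed
    then have rv: "norm (rejection v (c - q)) = norm (Fv, \<pi> m - \<delta>v)"
      by simp
    have "(norm (rejection (a *\<^sub>R u + b *\<^sub>R v) m))\<^sup>2 = (norm (\<pi> m))\<^sup>2 + (a * Fu + b * Fv)\<^sup>2"
    proof -
      have one: "a\<^sup>2 + b\<^sup>2 + 2 * a * b * \<gamma> = 1"
        using z unfolding norm_eq_1
        by (simp add: inner_add_left inner_add_right uu power2_eq_square algebra_simps)
      have "(norm (rejection (a *\<^sub>R u + b *\<^sub>R v) m))\<^sup>2 = (norm m)\<^sup>2 - (a * x + b * y)\<^sup>2"
        unfolding norm_rejection[OF z] by (simp add: x_def y_def inner_add_right)
      also have "\<dots> = (norm (\<pi> m))\<^sup>2 + (x\<^sup>2 + (y - \<gamma> * x)\<^sup>2 / k2 - (a * x + b * y)\<^sup>2)"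
        using pyth[of m] by (simp add: x_def y_def)
      also have "x\<^sup>2 + (y - \<gamma> * x)\<^sup>2 / k2 - (a * x + b * y)\<^sup>2
          = (x\<^sup>2 * k2 + (y - \<gamma> * x)\<^sup>2 - (a * x + b * y)\<^sup>2 * k2) / k2"
        using k2 by (simp add: add_divide_distrib diff_divide_distrib)
      also have "x\<^sup>2 * k2 + (y - \<gamma> * x)\<^sup>2 - (a * x + b * y)\<^sup>2 * k2
          = (a\<^sup>2 + b\<^sup>2 + 2 * a * b * \<gamma>) * (x\<^sup>2 * k2 + (y - \<gamma> * x)\<^sup>2) - (a * x + b * y)\<^sup>2 * k2"
        by (simp add: one)
      also have "\<dots> = (a * (\<gamma> * x - y) + b * (x - \<gamma> * y))\<^sup>2"
        unfolding k2_def by algebra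
      also have "\<dots> / k2 = (a * Fu + b * Fv)\<^sup>2"
        by (simp add: Fu_def Fv_def power_divide k flip: add_divide_distrib)
      finally show ?thesis .
    qed
    moreover have "a *\<^sub>R (Fu, \<pi> m - \<delta>u) + b *\<^sub>R (Fv, \<pi> m - \<delta>v) = (a * Fu + b * Fv, (a + b) *\<^sub>R \<pi> m)"
      using cancel by (simp add: algebra_simps)
    moreover have "(norm (\<pi> m))\<^sup>2 \<le> (norm ((a + b) *\<^sub>R \<pi> m))\<^sup>2"
      using ab one_le by (intro power_mono) (simp_all add: mult_le_cancel_right1)
    ultimately have "(norm (rejection (a *\<^sub>R u + b *\<^sub>R v) m))\<^sup>2 \<le> (norm (a *\<^sub>R (Fu, \<pi> m - \<delta>u) + b *\<^sub>R (Fv, \<pi> m - \<delta>v)))\<^sup>2"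
      by (simp add: norm_Pair)
    then have "norm (rejection (a *\<^sub>R u + b *\<^sub>R v) m) \<le> norm (a *\<^sub>R (Fu, \<pi> m - \<delta>u) + b *\<^sub>R (Fv, \<pi> m - \<delta>v))"
      by (rule power2_le_imp_le) simp
    also have "\<dots> \<le> a * norm (Fu, \<pi> m - \<delta>u) + b * norm (Fv, \<pi> m - \<delta>v)"
      using ab by (intro order_trans[OF norm_triangle_ineq]) (simp del: scaleR_Pair)
    finally show ?thesis by (simp add: ru rv m_def)
  qed
  then show ?thesis by blast
qed

section \<open>Two disjoint balls\<close>

lemma weighted_norms:
  fixes x y :: "'a::real_inner"
  assumes "0 < r" "0 < r'"
  shows "r' * (norm x)\<^sup>2 + r * (norm y)\<^sup>2 =
    (r + r') * ((norm ((r' / (r + r')) *\<^sub>R x + (r / (r + r')) *\<^sub>R y))\<^sup>2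
                + r * r' / (r + r')\<^sup>2 * (norm (x - y))\<^sup>2)"
proof -
  define s where "s = r + r'"
  have s: "0 < s" using assms by (simp add: s_def)
  have "s\<^sup>2 * (norm ((r' / s) *\<^sub>R x + (r / s) *\<^sub>R y))\<^sup>2 = (norm (r' *\<^sub>R x + r *\<^sub>R y))\<^sup>2"
  proof -
    have "s *\<^sub>R ((r' / s) *\<^sub>R x + (r / s) *\<^sub>R y) = r' *\<^sub>R x + r *\<^sub>R y"
      using s by (simp add: scaleR_add_right)
    then have "norm (r' *\<^sub>R x + r *\<^sub>R y) = s * norm ((r' / s) *\<^sub>R x + (r / s) *\<^sub>R y)"
      using s by (metis norm_scaleR abs_of_pos)
    then show ?thesis by (simp add: power_mult_distrib)
  qed
  moreover have "(norm (r' *\<^sub>R x + r *\<^sub>R y))\<^sup>2 + r * r' * (norm (x - y))\<^sup>2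
      = s * (r' * (norm x)\<^sup>2 + r * (norm y)\<^sup>2)"
    unfolding power2_norm_eq_inner s_def
    by (simp add: inner_diff_left inner_diff_right inner_add_left inner_add_right inner_commute algebra_simps)
  moreover have "s\<^sup>2 * (r * r' / s\<^sup>2 * (norm (x - y))\<^sup>2) = r * r' * (norm (x - y))\<^sup>2"
    using s by simp
  ultimately have "s * (s * ((norm ((r' / s) *\<^sub>R x + (r / s) *\<^sub>R y))\<^sup>2 + r * r' / s\<^sup>2 * (norm (x - y))\<^sup>2))
      = s * (r' * (norm x)\<^sup>2 + r * (norm y)\<^sup>2)"
    by (simp only: power2_eq_square[of s] distrib_left mult.assoc)
  then show ?thesis using s by (simp add: s_def)
qed

text \<open>
  Minkowski's inequality for the vectors \<open>(p, sqrt g)\<close> and \<open>(q, sqrt g)\<close>, with bounds in place of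
  their norms.
\<close>

lemma minkowski_with_common_component:
  fixes g :: real
  assumes "p\<^sup>2 + g \<le> P\<^sup>2" "q\<^sup>2 + g \<le> Q\<^sup>2" "0 \<le> P" "0 \<le> Q" "0 \<le> g" "0 \<le> a" "0 \<le> b"
  shows "(a * p + b * q)\<^sup>2 + (a + b)\<^sup>2 * g \<le> (a * P + b * Q)\<^sup>2"
proof -
  have "(p * q + g)\<^sup>2 \<le> (p * q + g)\<^sup>2 + g * (p - q)\<^sup>2" using assms by simp
  also have "\<dots> = (p\<^sup>2 + g) * (q\<^sup>2 + g)" by algebra
  also have "\<dots> \<le> P\<^sup>2 * Q\<^sup>2" using assms by (intro mult_mono) auto
  finally have "(p * q + g)\<^sup>2 \<le> (P * Q)\<^sup>2" by (simp add: power_mult_distrib)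
  then have "p * q + g \<le> P * Q" by (rule power2_le_imp_le) (use assms in simp)
  then have "2 * (a * b) * (p * q + g) \<le> 2 * (a * b) * (P * Q)"
    using assms by (intro mult_left_mono) auto
  moreover have "a\<^sup>2 * (p\<^sup>2 + g) \<le> a\<^sup>2 * P\<^sup>2" "b\<^sup>2 * (q\<^sup>2 + g) \<le> b\<^sup>2 * Q\<^sup>2"
    using assms by (auto intro: mult_left_mono)
  moreover have "(a * p + b * q)\<^sup>2 + (a + b)\<^sup>2 * g
      = a\<^sup>2 * (p\<^sup>2 + g) + b\<^sup>2 * (q\<^sup>2 + g) + 2 * (a * b) * (p * q + g)" by algebra
  moreover have "(a * P + b * Q)\<^sup>2 = a\<^sup>2 * P\<^sup>2 + b\<^sup>2 * Q\<^sup>2 + 2 * (a * b) * (P * Q)" by algebra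
  ultimately show ?thesis by linarith
qed

text \<open>
  This turns a condition on the distances to the two centres into one on the distance to a single
  point. With the radii swapped in the weights, the weighted sum of the squared radii is
  \<open>r' r\<^sup>2 + r r'\<^sup>2 = (r + r') (r r' / (r + r')\<^sup>2) (r + r')\<^sup>2\<close>, which is exactly the last term for
  \<open>dist c c' = r + r'\<close> without the contribution of \<open>u\<close>; other weights would lose something here.
\<close>

lemma weighted_distances_to_line:
  fixes u :: "'a::real_inner"
  assumes u: "norm u = 1" and r: "0 < r" "0 < r'"
  shows "r' * (norm (rejection u (c - p)))\<^sup>2 + r * (norm (rejection u (c' - p)))\<^sup>2 =
    (r + r') * ((norm (rejection u ((r' / (r + r')) *\<^sub>R c + (r / (r + r')) *\<^sub>R c' - p)))\<^sup>2
                + r * r' / (r + r')\<^sup>2 * ((dist c c')\<^sup>2 - ((c' - c) \<bullet> u)\<^sup>2))"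
proof -
  have one: "r' / (r + r') + r / (r + r') = 1" using r by (simp flip: add_divide_distrib)
  have "(r' / (r + r')) *\<^sub>R rejection u (c - p) + (r / (r + r')) *\<^sub>R rejection u (c' - p)
      = rejection u ((r' / (r + r')) *\<^sub>R (c - p) + (r / (r + r')) *\<^sub>R (c' - p))"
    by (simp add: rejection_add rejection_scaleR)
  also have "(r' / (r + r')) *\<^sub>R (c - p) + (r / (r + r')) *\<^sub>R (c' - p)
      = (r' / (r + r')) *\<^sub>R c + (r / (r + r')) *\<^sub>R c' - (r' / (r + r') + r / (r + r')) *\<^sub>R p"
    by (simp add: scaleR_diff_right scaleR_add_left)
  finally have 1: "(r' / (r + r')) *\<^sub>R rejection u (c - p) + (r / (r + r')) *\<^sub>R rejection u (c' - p)
      = rejection u ((r' / (r + r')) *\<^sub>R c + (r / (r + r')) *\<^sub>R c' - p)"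
    by (simp add: one)
  have 2: "(norm (rejection u (c - p) - rejection u (c' - p)))\<^sup>2 = (dist c c')\<^sup>2 - ((c' - c) \<bullet> u)\<^sup>2"
  proof -
    have "rejection u (c - p) - rejection u (c' - p) = rejection u (c - c')"
      by (simp flip: rejection_diff)
    moreover have "((c - c') \<bullet> u)\<^sup>2 = ((c' - c) \<bullet> u)\<^sup>2"
      by (simp add: inner_diff_left power2_commute)
    ultimately show ?thesis by (simp add: norm_rejection[OF u] dist_norm)
  qed
  show ?thesis
    using weighted_norms[OF r, of "rejection u (c - p)" "rejection u (c' - p)"] unfolding 1 2 .
qed

text \<open>
  The first conclusion is equivalent, for the line through \<open>o'\<close> of direction \<open>w\<close>, to the strict
  form of the cone condition \<open>cone\<close> that every line meeting both balls satisfies. Unlike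
  meeting the balls one by one, that condition is preserved by the mean of lines. The second conclusion is
  that the projections of the two balls along \<open>w\<close> intersect; it holds since the directions making
  a sufficiently small angle with \<open>c' - c\<close> form a convex cone.
\<close>

lemma pair_on_combined_line:
  fixes u v :: "'a::real_inner"
  assumes u: "norm u = 1" and v: "norm v = 1"
    and ab: "0 < a" "0 < b" "1 < a + b" and w: "norm w = 1" "w = a *\<^sub>R u + b *\<^sub>R v"
    and line: "\<And>c. norm (rejection w (c - o'))
           \<le> a * norm (rejection u (c - p)) + b * norm (rejection v (c - q))"
    and r: "0 < r" "0 < r'" "r + r' < dist c c'"
    and order: "0 < (c' - c) \<bullet> u" "0 < (c' - c) \<bullet> v"
    and u_meets: "norm (rejection u (c - p)) \<le> r" "norm (rejection u (c' - p)) \<le> r'"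
    and v_meets: "norm (rejection v (c - q)) \<le> r" "norm (rejection v (c' - q)) \<le> r'"
  shows "r' * (norm (rejection w (c - o')))\<^sup>2 + r * (norm (rejection w (c' - o')))\<^sup>2 < r * r' * (r + r')"
    and "norm (rejection w (c - o') - rejection w (c' - o')) \<le> r + r'"
proof -
  define s m \<kappa> g where "s = r + r'" and "m = (r' / (r + r')) *\<^sub>R c + (r / (r + r')) *\<^sub>R c'"
    and "\<kappa> = r * r' / (r + r')\<^sup>2" and "g = \<kappa> * ((dist c c')\<^sup>2 - (r + r')\<^sup>2)"
  have pos: "0 < s" "0 < \<kappa>" "0 < r * r'" using r by (simp_all add: s_def \<kappa>_def)
  have "(r + r')\<^sup>2 < (dist c c')\<^sup>2" using r by (intro power_strict_mono) auto
  then have g: "0 < g" using pos by (simp add: g_def)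
  have \<kappa>s: "\<kappa> * s\<^sup>2 = r * r'" using pos by (simp add: \<kappa>_def s_def)
  have sum: "r' * (norm (rejection x (c - y)))\<^sup>2 + r * (norm (rejection x (c' - y)))\<^sup>2 =
    s * ((norm (rejection x (m - y)))\<^sup>2 + g - (sqrt \<kappa> * ((c' - c) \<bullet> x))\<^sup>2) + r * r' * s"
    if "norm x = 1" for x y
  proof -
    have "(norm (rejection x (m - y)))\<^sup>2 + \<kappa> * ((dist c c')\<^sup>2 - ((c' - c) \<bullet> x)\<^sup>2)
       = ((norm (rejection x (m - y)))\<^sup>2 + g - (sqrt \<kappa> * ((c' - c) \<bullet> x))\<^sup>2) + r * r'"
      using pos unfolding \<kappa>s[symmetric] g_def s_def[symmetric] power_mult_distrib
      by (simp add: right_diff_distrib)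
    moreover have "r' * (norm (rejection x (c - y)))\<^sup>2 + r * (norm (rejection x (c' - y)))\<^sup>2 =
      s * ((norm (rejection x (m - y)))\<^sup>2 + \<kappa> * ((dist c c')\<^sup>2 - ((c' - c) \<bullet> x)\<^sup>2))"
      using weighted_distances_to_line[OF that r(1,2), of c y c']
      unfolding m_def \<kappa>_def s_def .
    ultimately show ?thesis by (simp only: distrib_left mult.commute)
  qed
  have cone: "(norm (rejection x (m - y)))\<^sup>2 + g \<le> (sqrt \<kappa> * ((c' - c) \<bullet> x))\<^sup>2"
    if x: "norm x = 1" and meets: "norm (rejection x (c - y)) \<le> r" "norm (rejection x (c' - y)) \<le> r'" for x y
  proof -
    have "r' * (norm (rejection x (c - y)))\<^sup>2 + r * (norm (rejection x (c' - y)))\<^sup>2 \<le> r' * r\<^sup>2 + r * r'\<^sup>2"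
      using meets r by (intro add_mono mult_left_mono power_mono) auto
    also have "\<dots> = r * r' * s" by (simp add: s_def power2_eq_square algebra_simps)
    finally have "s * ((norm (rejection x (m - y)))\<^sup>2 + g - (sqrt \<kappa> * ((c' - c) \<bullet> x))\<^sup>2) \<le> 0"
      unfolding sum[OF x] by simp
    then show ?thesis using pos by (simp add: mult_le_0_iff)
  qed
  let ?p = "norm (rejection u (m - p))" and ?q = "norm (rejection v (m - q))"
  have "(norm (rejection w (m - o')))\<^sup>2 \<le> (a * ?p + b * ?q)\<^sup>2"
    by (intro power_mono line) simp
  moreover have "g < (a + b)\<^sup>2 * g"
    using ab g by (simp add: one_less_power)
  moreover have "(a * ?p + b * ?q)\<^sup>2 + (a + b)\<^sup>2 * g
      \<le> (a * (sqrt \<kappa> * ((c' - c) \<bullet> u)) + b * (sqrt \<kappa> * ((c' - c) \<bullet> v)))\<^sup>2"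
    using order ab g pos
    by (intro minkowski_with_common_component cone u v u_meets v_meets) auto
  moreover have "a * (sqrt \<kappa> * ((c' - c) \<bullet> u)) + b * (sqrt \<kappa> * ((c' - c) \<bullet> v)) = sqrt \<kappa> * ((c' - c) \<bullet> w)"
    by (simp add: w inner_add_right algebra_simps)
  ultimately have "(norm (rejection w (m - o')))\<^sup>2 + g - (sqrt \<kappa> * ((c' - c) \<bullet> w))\<^sup>2 < 0"
    by simp
  then show "r' * (norm (rejection w (c - o')))\<^sup>2 + r * (norm (rejection w (c' - o')))\<^sup>2 < r * r' * (r + r')"
    unfolding sum[OF w(1)] using pos by (simp add: s_def mult_pos_neg)

  (* a unit vector x is the direction of a line meeting both balls in order iff K \<le> (c' - c) \<bullet> x *)
  define K where "K = sqrt ((dist c c')\<^sup>2 - s\<^sup>2)"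
  have K: "0 \<le> K" "K\<^sup>2 = (dist c c')\<^sup>2 - s\<^sup>2"
    using \<open>(r + r')\<^sup>2 < (dist c c')\<^sup>2\<close> by (simp_all add: K_def s_def)
  have nr: "(norm (rejection x (c - c')))\<^sup>2 = (dist c c')\<^sup>2 - ((c' - c) \<bullet> x)\<^sup>2" if "norm x = 1" for x
    unfolding norm_rejection[OF that] dist_norm by (simp add: inner_diff_left power2_commute)
  have step: "K \<le> (c' - c) \<bullet> x"
    if x: "norm x = 1" and meets: "norm (rejection x (c - y)) \<le> r" "norm (rejection x (c' - y)) \<le> r'"
      and pos: "0 < (c' - c) \<bullet> x" for x y
  proof (rule power2_le_imp_le)
    have "rejection x (c - c') = rejection x (c - y) - rejection x (c' - y)"
      by (simp flip: rejection_diff)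
    then have "norm (rejection x (c - c')) \<le> s"
      using norm_triangle_ineq4[of "rejection x (c - y)" "rejection x (c' - y)"] meets by (simp add: s_def)
    then have "(norm (rejection x (c - c')))\<^sup>2 \<le> s\<^sup>2" by (intro power_mono) auto
    then show "K\<^sup>2 \<le> ((c' - c) \<bullet> x)\<^sup>2" unfolding nr[OF x] K(2) by linarith
    show "0 \<le> (c' - c) \<bullet> x" using pos by simp
  qed
  have "1 * K \<le> (a + b) * K" using ab K by (intro mult_right_mono) auto
  also have "\<dots> = a * K + b * K" by (simp add: algebra_simps)
  also have "\<dots> \<le> a * ((c' - c) \<bullet> u) + b * ((c' - c) \<bullet> v)"
    using ab by (intro add_mono mult_left_mono step[OF u u_meets] step[OF v v_meets] order) auto
  also have "\<dots> = (c' - c) \<bullet> w" by (simp add: w inner_add_right)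
  finally have "K\<^sup>2 \<le> ((c' - c) \<bullet> w)\<^sup>2" using K by (intro power_mono) auto
  then have "(norm (rejection w (c - c')))\<^sup>2 \<le> s\<^sup>2"
    unfolding nr[OF w(1)] K(2) by linarith
  then have "norm (rejection w (c - c')) \<le> s" by (rule power2_le_imp_le) (use pos in simp)
  then show "norm (rejection w (c - o') - rejection w (c' - o')) \<le> r + r'"
    by (simp add: s_def flip: rejection_diff)
qed

section \<open>Balls with a common point\<close>

text \<open>
  By \<open>power\<close> at most one ball, of index \<open>k\<close> say, does not have \<open>0\<close> in its interior.
  The point \<open>x\<close> of that ball nearest to \<open>0\<close> lies at distance \<open>e = norm (G k) - r k\<close> from \<open>0\<close>.
  Moving from \<open>0\<close> to \<open>x\<close> may lead away from another centre \<open>G j\<close>, but \<open>touch\<close> limits the angle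
  between \<open>G j\<close> and \<open>G k\<close> and hence the growth of that distance, and \<open>power\<close> says that \<open>0\<close> lies
  deep enough in ball \<open>j\<close> to allow for it. So \<open>x\<close> is in the interior of all the other balls, and it
  is a limit of interior points of ball \<open>k\<close>.
\<close>

lemma balls_have_common_interior_point:
  fixes G :: "'i \<Rightarrow> 'a::real_inner"
  assumes fin: "finite I" and r: "\<And>i. i \<in> I \<Longrightarrow> 0 < r i"
    and touch: "\<And>i j. i \<in> I \<Longrightarrow> j \<in> I \<Longrightarrow> i \<noteq> j \<Longrightarrow> norm (G i - G j) \<le> r i + r j"
    and power: "\<And>i j. i \<in> I \<Longrightarrow> j \<in> I \<Longrightarrow> i \<noteq> j \<Longrightarrow>
      r j * (norm (G i))\<^sup>2 + r i * (norm (G j))\<^sup>2 < r i * r j * (r i + r j)"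
  shows "\<exists>x. \<forall>i\<in>I. norm (G i - x) < r i"
proof (cases "\<forall>i\<in>I. norm (G i) < r i")
  case True
  then have "\<forall>i\<in>I. norm (G i - 0) < r i" by simp
  then show ?thesis by blast
next
  case False
  then obtain k where k: "k \<in> I" "r k \<le> norm (G k)" by force
  define N e where "N = norm (G k)" and "e = norm (G k) - r k"
  define x where "x = (e / N) *\<^sub>R G k"
  have rk: "0 < r k" and e: "0 \<le> e" and Ne: "N = r k + e"
    using k r[OF k(1)] by (simp_all add: N_def e_def)
  then have N: "0 < N" by linarith
  have near: "norm (G j - x) < r j" if j: "j \<in> I" "j \<noteq> k" for j
  proof -
    define P where "P = (norm (G j))\<^sup>2"
    have rj: "0 < r j" using j r by blast
    have "(norm (G k - G j))\<^sup>2 \<le> (r k + r j)\<^sup>2"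
      using touch[OF k(1) j(1)] j by (intro power_mono) auto
    then have inner: "N\<^sup>2 + P - (r k + r j)\<^sup>2 \<le> 2 * (G k \<bullet> G j)"
      unfolding P_def N_def power2_norm_eq_inner
      by (simp add: inner_diff_left inner_diff_right inner_commute)
    have xk: "(norm x)\<^sup>2 = e\<^sup>2"
      using N e by (simp add: x_def N_def power_mult_distrib)
    have "(norm (G j - x))\<^sup>2 = P - (e / N) * (2 * (G k \<bullet> G j)) + e\<^sup>2"
      unfolding xk[symmetric] P_def power2_norm_eq_inner
      by (simp add: inner_diff_left inner_diff_right inner_commute x_def)
    also have "\<dots> \<le> P - (e / N) * (N\<^sup>2 + P - (r k + r j)\<^sup>2) + e\<^sup>2"
      using inner N e by (intro add_right_mono diff_left_mono mult_left_mono) auto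
    finally have "N * (norm (G j - x))\<^sup>2 \<le> N * (P - (e / N) * (N\<^sup>2 + P - (r k + r j)\<^sup>2) + e\<^sup>2)"
      using N by (intro mult_left_mono) auto
    also have "\<dots> = N * P - e * (N\<^sup>2 + P - (r k + r j)\<^sup>2) + N * e\<^sup>2"
      using N by (simp add: algebra_simps)
    also have "\<dots> = (r j * N\<^sup>2 + r k * P) + (2 * r k * r j * e + (r j)\<^sup>2 * e - r j * N\<^sup>2 - r k * e\<^sup>2)"
      unfolding Ne by algebra
    also have "\<dots> < r k * r j * (r k + r j) + (2 * r k * r j * e + (r j)\<^sup>2 * e - r j * N\<^sup>2 - r k * e\<^sup>2)"
      using power[OF k(1) j(1)] j by (simp add: N_def P_def)
    also have "\<dots> = N * (r j)\<^sup>2 - (r j + r k) * e\<^sup>2"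
      unfolding Ne by algebra
    also have "\<dots> \<le> N * (r j)\<^sup>2" using rk rj by simp
    finally have "(norm (G j - x))\<^sup>2 < (r j)\<^sup>2" using N by simp
    then show ?thesis by (rule power2_less_imp_less) (use rj in simp)
  qed
  have "G k - x = (r k / N) *\<^sub>R G k"
  proof -
    have "r k / N = 1 - e / N" using N Ne by (simp add: field_simps)
    then show ?thesis by (simp add: x_def scaleR_diff_left)
  qed
  then have "dist (G k) x = r k"
    using N rk by (simp add: dist_norm N_def)
  then have "x \<in> closure (ball (G k) (r k))" using rk by simp
  moreover have "open (\<Inter>j\<in>I - {k}. ball (G j) (r j))"
    using fin by (intro open_INT) auto
  moreover have "x \<in> (\<Inter>j\<in>I - {k}. ball (G j) (r j))"
    using near by (simp add: dist_norm)
  ultimately obtain y where "y \<in> ball (G k) (r k)" "y \<in> (\<Inter>j\<in>I - {k}. ball (G j) (r j))"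
    by (meson closure_iff_nhds_not_empty disjoint_iff subset_refl)
  then have "\<forall>i\<in>I. norm (G i - y) < r i" by (auto simp: dist_norm)
  then show ?thesis by blast
qed

section \<open>Directions of transversals\<close>

locale disjoint_balls =
  fixes \<S> :: "'a::real_inner set set" and c :: "'a set \<Rightarrow> 'a" and r :: "'a set \<Rightarrow> real"
  assumes finite: "finite \<S>"
    and ball: "B \<in> \<S> \<Longrightarrow> B = cball (c B) (r B)"
    and radius: "B \<in> \<S> \<Longrightarrow> 0 < r B"
    and disjoint: "pairwise disjnt \<S>"
begin

lemma disjnt_cballs:
  "A \<in> \<S> \<Longrightarrow> B \<in> \<S> \<Longrightarrow> A \<noteq> B \<Longrightarrow> disjnt (cball (c A) (r A)) (cball (c B) (r B))"
  using disjoint ball by (metis pairwiseD)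

lemma meets_in_order_iff:
  assumes "norm u = 1"
  shows "meets_in_order p u \<S> R \<longleftrightarrow>
    (\<forall>B\<in>\<S>. norm (rejection u (c B - p)) \<le> r B) \<and>
    (\<forall>A\<in>\<S>. \<forall>B\<in>\<S>. (A, B) \<in> R \<and> A \<noteq> B \<longrightarrow> 0 < (c B - c A) \<bullet> u)"
proof -
  have meets: "(\<forall>B\<in>\<S>. \<exists>t. p + t *\<^sub>R u \<in> B) \<longleftrightarrow> (\<forall>B\<in>\<S>. norm (rejection u (c B - p)) \<le> r B)"
    using ball by (simp flip: line_meets_cball_iff[OF assms])
  have order: "(\<forall>s t. p + s *\<^sub>R u \<in> A \<and> p + t *\<^sub>R u \<in> B \<longrightarrow> s < t) \<longleftrightarrow> 0 < (c B - c A) \<bullet> u"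
    if AB: "A \<in> \<S>" "B \<in> \<S>" "A \<noteq> B" and m: "\<forall>B\<in>\<S>. \<exists>t. p + t *\<^sub>R u \<in> B" for A B
  proof -
    obtain s t where "p + s *\<^sub>R u \<in> cball (c A) (r A)" "p + t *\<^sub>R u \<in> cball (c B) (r B)"
      using m AB ball by metis
    from order_iff_centres[OF assms disjnt_cballs[OF AB] this] show ?thesis
      unfolding ball[OF AB(1), symmetric] ball[OF AB(2), symmetric] .
  qed
  show ?thesis unfolding meets_in_order_def meets[symmetric]
    by (intro conj_cong ball_cong imp_cong refl, rule order) blast+
qed

text \<open>
  A nearby direction \<open>w\<close> is realised by the line through the same point \<open>p\<close>: on it, the point with
  the parameter of the old foot is still inside the ball.
\<close>

lemma in_interior_if_strict_transversal:
  assumes u: "norm u = 1"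
    and meets: "\<And>B. B \<in> \<S> \<Longrightarrow> norm (rejection u (c B - p)) < r B"
    and order: "\<And>A B. A \<in> \<S> \<Longrightarrow> B \<in> \<S> \<Longrightarrow> (A, B) \<in> R \<Longrightarrow> A \<noteq> B \<Longrightarrow> 0 < (c B - c A) \<bullet> u"
  shows "u \<in> top_of_set (sphere 0 1) interior_of (transversal_directions \<S> R)"
proof -
  define t where "t B = (c B - p) \<bullet> u" for B
  define W where "W = (\<Inter>B\<in>\<S>. {w. dist (c B) (p + t B *\<^sub>R w) < r B}) \<inter>
    (\<Inter>A\<in>\<S>. \<Inter>B\<in>\<S>. {w. (A, B) \<in> R \<and> A \<noteq> B \<longrightarrow> 0 < (c B - c A) \<bullet> w})"
  have "open {w. (A, B) \<in> R \<and> A \<noteq> B \<longrightarrow> 0 < (c B - c A) \<bullet> w}" for A B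
    by (cases "(A, B) \<in> R \<and> A \<noteq> B") (auto intro!: open_Collect_less continuous_intros)
  moreover have "open {w. dist (c B) (p + t B *\<^sub>R w) < r B}" for B
    by (intro open_Collect_less continuous_intros)
  ultimately have "open W"
    unfolding W_def using finite by (intro open_Int open_INT ballI) auto
  moreover have "u \<in> W"
    using meets order by (auto simp: W_def t_def dist_foot)
  moreover have "sphere 0 1 \<inter> W \<subseteq> transversal_directions \<S> R"
  proof
    fix w assume w: "w \<in> sphere 0 1 \<inter> W"
    then have n: "norm w = 1" by simp
    have "norm (rejection w (c B - p)) \<le> r B" if "B \<in> \<S>" for B
    proof -
      have "dist (c B) (p + t B *\<^sub>R w) < r B" using w that by (simp add: W_def)
      then show ?thesis using norm_rejection_le_dist[OF n, of "c B" p "t B"] by linarith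
    qed
    moreover have "0 < (c B - c A) \<bullet> w" if "A \<in> \<S>" "B \<in> \<S>" "(A, B) \<in> R" "A \<noteq> B" for A B
      using w that by (auto simp: W_def)
    ultimately have "meets_in_order p w \<S> R" unfolding meets_in_order_iff[OF n] by blast
    then show "w \<in> transversal_directions \<S> R" using w by (auto simp: transversal_directions_def)
  qed
  ultimately show ?thesis
    using u unfolding interior_of_def mem_Collect_eq
    by (intro exI[of _ "sphere 0 1 \<inter> W"]) (auto simp: openin_open)
qed

text \<open>
  A parallel shift of the mean line by \<open>x\<close> replaces the vectors \<open>G B\<close> from the line to the centres
  by \<open>G B - x\<close> without its component along \<open>w\<close>, which is no longer than \<open>G B - x\<close>. So a common interior point
  of the balls about \<open>G B\<close> gives the required line.
\<close>

lemma open_arc_in_interior: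
  assumes R: "linear_order_on \<S> R"
    and u: "u \<in> transversal_directions \<S> R" and v: "v \<in> transversal_directions \<S> R"
    and uv: "v \<noteq> u" "v \<noteq> - u"
    and ab: "0 < a" "0 < b" and z: "norm (a *\<^sub>R u + b *\<^sub>R v) = 1"
  shows "a *\<^sub>R u + b *\<^sub>R v \<in> top_of_set (sphere 0 1) interior_of (transversal_directions \<S> R)"
proof -
  define w where "w = a *\<^sub>R u + b *\<^sub>R v"
  have w: "norm w = 1" using z by (simp add: w_def)
  obtain p q where nu: "norm u = 1" and nv: "norm v = 1"
    and p: "meets_in_order p u \<S> R" and q: "meets_in_order q v \<S> R"
    using u v by (auto simp: transversal_directions_def)
  note p = p[unfolded meets_in_order_iff[OF nu]] and q = q[unfolded meets_in_order_iff[OF nv]]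
  have order_w: "0 < (c B - c A) \<bullet> w" if "A \<in> \<S>" "B \<in> \<S>" "(A, B) \<in> R" "A \<noteq> B" for A B
  proof -
    have "0 < (c B - c A) \<bullet> u" "0 < (c B - c A) \<bullet> v" using p q that by blast+
    then show ?thesis using ab by (simp add: w_def inner_add_right add_pos_pos)
  qed
  obtain o' where line: "\<And>c. norm (rejection w (c - o'))
           \<le> a * norm (rejection u (c - p)) + b * norm (rejection v (c - q))"
    using line_combination[OF nu nv uv ab z, of p q] unfolding w_def by blast
  define G where "G B = rejection w (c B - o')" for B
  have pair: "norm (G A - G B) \<le> r A + r B \<and>
      r B * (norm (G A))\<^sup>2 + r A * (norm (G B))\<^sup>2 < r A * r B * (r A + r B)"
    if AB: "A \<in> \<S>" "B \<in> \<S>" "A \<noteq> B" and "(A, B) \<in> R" for A B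
  proof -
    have "r A + r B < dist (c A) (c B)"
      by (rule disjnt_cball_imp_dist) (use AB disjnt_cballs radius in auto)
    moreover have "1 < a + b"
      by (rule coefficients_of_arc_point) (use nu nv uv ab z in auto)
    ultimately show ?thesis
      unfolding G_def using p q that
      by (intro conjI pair_on_combined_line[OF nu nv ab _ w w_def line radius[OF AB(1)] radius[OF AB(2)]])
        auto
  qed
  have "\<exists>x. \<forall>B\<in>\<S>. norm (G B - x) < r B"
  proof (rule balls_have_common_interior_point[OF finite radius])
    fix A B assume AB: "A \<in> \<S>" "B \<in> \<S>" "A \<noteq> B"
    then have "(A, B) \<in> R \<or> (B, A) \<in> R"
      using R by (auto simp: linear_order_on_def total_on_def)
    then have "norm (G A - G B) \<le> r A + r B \<and>
      r B * (norm (G A))\<^sup>2 + r A * (norm (G B))\<^sup>2 < r A * r B * (r A + r B)"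
      using pair[OF AB] pair[OF AB(2,1)] AB by (auto simp: norm_minus_commute algebra_simps)
    then show "norm (G A - G B) \<le> r A + r B"
      and "r B * (norm (G A))\<^sup>2 + r A * (norm (G B))\<^sup>2 < r A * r B * (r A + r B)" by auto
  qed
  then obtain x where x: "\<And>B. B \<in> \<S> \<Longrightarrow> norm (G B - x) < r B" by blast
  have "norm (rejection w (c B - (o' + x))) < r B" if "B \<in> \<S>" for B
  proof -
    have "rejection w (c B - (o' + x)) = rejection w (c B - o' - x)" by (simp add: algebra_simps)
    also have "\<dots> = rejection w (G B - x)"
      using w by (simp add: G_def rejection_diff rejection_idem)
    finally show ?thesis
      using norm_rejection_le_dist[OF w, of "G B" x 0] x[OF that] by (simp add: dist_norm)
  qed
  then show ?thesis
    using in_interior_if_strict_transversal[OF w _ order_w] unfolding w_def by blast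
qed

lemma strictly_convex:
  assumes "linear_order_on \<S> R"
  shows "strictly_spherically_convex (transversal_directions \<S> R)"
proof -
  let ?K = "transversal_directions \<S> R"
  have sphere: "?K \<subseteq> sphere 0 1" by (auto simp: transversal_directions_def)
  have arc: "z \<in> {x, y} \<or> (x \<noteq> y \<and> z \<in> top_of_set (sphere 0 1) interior_of ?K)"
    if x: "x \<in> ?K" and y: "y \<in> ?K" and anti: "y \<noteq> - x" and z: "z \<in> great_circle_arc x y" for x y z
  proof -
    have n: "norm x = 1" "norm y = 1" using x y sphere by auto
    obtain a b where ab: "0 \<le> a" "0 \<le> b" and z': "z = a *\<^sub>R x + b *\<^sub>R y" "norm z = 1"
      using z by (auto simp: great_circle_arc_def)
    consider "a = 0" | "b = 0" | "x = y" | "0 < a" "0 < b" "x \<noteq> y" using ab by fastforce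
    then show ?thesis
    proof cases
      case 1
      then show ?thesis using z' ab n by simp
    next
      case 2
      then show ?thesis using z' ab n by simp
    next
      case 3
      then have "z = (a + b) *\<^sub>R x" using z' by (simp add: scaleR_add_left)
      then show ?thesis using z' ab n by simp
    next
      case 4
      then show ?thesis using open_arc_in_interior[OF assms x y _ anti 4(1,2)] z' by metis
    qed
  qed
  have "z \<in> ?K" if "x \<in> ?K" "y \<in> ?K" "y \<noteq> - x" "z \<in> great_circle_arc x y" for x y z
    using arc[OF that] that(1,2) by (auto dest: subsetD[OF interior_of_subset])
  then show ?thesis
    using arc sphere unfolding strictly_spherically_convex_def spherically_convex_def by blast
qed

end

theorem theorem1:
  fixes \<S> :: "(real ^ 'd) set set" and R :: "(real ^ 'd) set rel"
  assumes "finite \<S>"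
    and "\<And>B. B \<in> \<S> \<Longrightarrow> \<exists>c r. 0 < r \<and> B = cball c r"
    and "pairwise disjnt \<S>"
    and "linear_order_on \<S> R"
  shows "strictly_spherically_convex (transversal_directions \<S> R)"
proof -
  obtain c r where "\<And>B. B \<in> \<S> \<Longrightarrow> 0 < r B \<and> B = cball (c B) (r B)"
    using assms(2) by metis
  then interpret disjoint_balls \<S> c r
    using assms by unfold_locales auto
  show ?thesis using assms(4) by (rule strictly_convex)
qed

end
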